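(* Let $\ell\ge 2$ be an integer, let $G$ be a $C_{\ell+1}$-free graph, and let $t=\lfloor \ell/2\rfloor$. Then for every vertex $v\in V(G)$, $\chi(B_t(v))\le 2\ell$.
   Context: $C_{\ell+1}$-free means $G$ contains no cycle of length exactly $\ell+1$ as a subgraph. $B_t(v)$ is the subgraph of $G$ induced by the vertices at distance at most $t$ from $v$. *)

theory Defs
  imports "Graph_Theory.Graph_Theory" "HOL-Library.Extended_Nat"
begin

text \<open>A simple graph, finite or infinite, is a \<^locale>\<open>pair_bidirected_digraph\<close>: a vertex set
  with a symmetric and irreflexive adjacency relation on it. The definitions below are stated for
  the underlying \<^typ>\<open>('a, 'b) pre_digraph\<close>.\<close>

text \<open>In a symmetric digraph an edge traversed back and forth is a
  \<^const>\<open>pre_digraph.cycle\<close> of length 2. For \<open>k \<ge> 3\<close> the cycles of length \<open>k\<close> are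
  exactly the (rooted and oriented) copies of the undirected cycle on \<open>k\<close> vertices.\<close>

definition cycle_free :: "nat \<Rightarrow> ('a, 'b) pre_digraph \<Rightarrow> bool" where
  "cycle_free k G \<longleftrightarrow> \<not> (\<exists>p. pre_digraph.cycle G p \<and> length p = k)"

text \<open>Infinite between vertices in different components.\<close>

definition gdist :: "('a, 'b) pre_digraph \<Rightarrow> 'a \<Rightarrow> 'a \<Rightarrow> ereal" where
  "gdist G u v = wf_digraph.\<mu> G (\<lambda>_. 1) u v"

definition gball :: "('a, 'b) pre_digraph \<Rightarrow> nat \<Rightarrow> 'a \<Rightarrow> ('a, 'b) pre_digraph" where
  "gball G t v = G \<restriction> {u \<in> verts G. gdist G v u \<le> ereal (real t)}"

definition colourable :: "nat \<Rightarrow> ('a, 'b) pre_digraph \<Rightarrow> bool" where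
  "colourable k G \<longleftrightarrow>
     (\<exists>c :: 'a \<Rightarrow> nat. c ` verts G \<subseteq> {..<k} \<and> (\<forall>u w. u \<rightarrow>\<^bsub>G\<^esub> w \<longrightarrow> c u \<noteq> c w))"

text \<open>The value is \<open>\<infinity>\<close> if no finite number of colours suffices.\<close>

definition chromatic_number :: "('a, 'b) pre_digraph \<Rightarrow> enat" where
  "chromatic_number G = (INF k \<in> {k. colourable k G}. enat k)"

end

theory Submission
  imports Defs
begin

text \<open>Order every level of a breadth-first search tree rooted at \<open>v\<close> lexicographically along the
  tree, so that the descendants of each tree vertex form an interval. If the subgraph induced by
  level \<open>i \<le> t\<close> is not \<open>(l - 1)\<close>-colourable, then it contains an increasing path
  \<open>s\<^sub>0 < \<dots> < s\<^sub>l\<^sub>-\<^sub>1\<close>. Let \<open>m \<le> i\<close> be the height of the last common ancestor of the whole path. Some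
  step of the path separates two subtrees just below this ancestor, and since the order is
  compatible with the tree, the ends \<open>s\<^sub>a, s\<^sub>b\<close> of every subpath containing this step have the same
  last common ancestor. As \<open>1 \<le> l + 1 - 2 m \<le> l - 1\<close>, we can take \<open>b - a = l + 1 - 2 m\<close>; the
  subpath then closes up with the two tree branches, of length \<open>m\<close> each, to a cycle of length
  \<open>l + 1\<close>. Hence every level is \<open>(l - 1)\<close>-colourable, and two disjoint palettes, for the even and
  the odd levels, suffice for the ball.\<close>

section \<open>Lexicographic order along iterated parents\<close>

text \<open>Parents are compared first, so ancestors nearer the root are the more significant
  letters. At height 0 both vertices are meant to be the root, hence nothing is smaller.\<close>

fun tree_less :: "'a rel \<Rightarrow> ('a \<Rightarrow> 'a) \<Rightarrow> nat \<Rightarrow> 'a \<Rightarrow> 'a \<Rightarrow> bool" where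
  "tree_less r p 0 x y \<longleftrightarrow> False"
| "tree_less r p (Suc n) x y \<longleftrightarrow> tree_less r p n (p x) (p y) \<or> p x = p y \<and> (x, y) \<in> r"

lemma tree_less_irrefl: "irrefl r \<Longrightarrow> \<not> tree_less r p n x x"
  by (induction n arbitrary: x) (auto simp: irrefl_def)

lemma tree_less_trans:
  "trans r \<Longrightarrow> tree_less r p n x y \<Longrightarrow> tree_less r p n y z \<Longrightarrow> tree_less r p n x z"
  by (induction n arbitrary: x y z) (auto dest: transD)

lemma tree_less_total:
  assumes "total r" "(p ^^ n) x = (p ^^ n) y" "x \<noteq> y"
  shows "tree_less r p n x y \<or> tree_less r p n y x"
  using assms(2,3)
proof (induction n arbitrary: x y)
  case (Suc n)
  from Suc.prems(1) have "(p ^^ n) (p x) = (p ^^ n) (p y)"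
    by (simp add: funpow_swap1)
  with Suc.IH[of "p x" "p y"] Suc.prems(2) \<open>total r\<close> show ?case
    by (cases "p x = p y") (auto simp: total_on_def)
qed simp

text \<open>Climbing \<open>j\<close> generations discards only the least significant letters, which
  merely break ties.\<close>

lemma tree_less_funpow:
  assumes "tree_less r p n x y" "j \<le> n"
  shows "tree_less r p (n - j) ((p ^^ j) x) ((p ^^ j) y) \<or> (p ^^ j) x = (p ^^ j) y"
  using assms
proof (induction j arbitrary: n x y)
  case (Suc j)
  then obtain n' where n: "n = Suc n'" "j \<le> n'"
    by (cases n) auto
  with Suc.prems have "tree_less r p n' (p x) (p y) \<or> p x = p y"
    by auto
  with Suc.IH[of n' "p x" "p y"] n show ?case
    by (auto simp: funpow_swap1)
qed simp

text \<open>Descendants form intervals: climbing is weakly monotone, so equal images of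
  \<open>x\<close> and \<open>z\<close> squeeze that of \<open>y\<close>.\<close>

lemma tree_less_between:
  assumes "irrefl r" "trans r" "j \<le> n"
    and "x = y \<or> tree_less r p n x y" "y = z \<or> tree_less r p n y z"
    and "(p ^^ j) x = (p ^^ j) z"
  shows "(p ^^ j) x = (p ^^ j) y"
  using assms tree_less_funpow[of r p n x y j] tree_less_funpow[of r p n y z j]
  by (metis tree_less_irrefl tree_less_trans)

lemma tree_less_chain:
  assumes "trans r" "\<And>c. c < k \<Longrightarrow> tree_less r p n (s c) (s (Suc c))" "a \<le> b" "b \<le> k"
  shows "s a = s b \<or> tree_less r p n (s a) (s b)"
  using assms(3,4)
proof (induction b rule: dec_induct)
  case (step b)
  then show ?case
    using assms(2)[of b] tree_less_trans[OF \<open>trans r\<close>] by (metis Suc_le_eq Suc_leD)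
qed simp

lemma tree_less_chain_inj:
  assumes "irrefl r" "trans r" "\<And>c. c < k \<Longrightarrow> tree_less r p n (s c) (s (Suc c))" "a < b" "b \<le> k"
  shows "s a \<noteq> s b"
proof -
  have "s (Suc a) = s b \<or> tree_less r p n (s (Suc a)) (s b)"
    using assms by (intro tree_less_chain[of r k]) auto
  then show ?thesis
    using assms by (metis tree_less_irrefl tree_less_trans less_le_trans)
qed

section \<open>Colouring along a relation without long chains\<close>

text \<open>Colour \<open>x\<close> by the length of a longest \<open>R\<close>-walk ending there;
  an arc out of \<open>x\<close> prolongs that walk.\<close>

lemma colouring_of_no_relpow:
  fixes R :: "'a rel"
  assumes "R ^^ k = {}"
  obtains f :: "'a \<Rightarrow> nat" where "\<And>x. f x < k" "\<And>x y. (x, y) \<in> R \<Longrightarrow> f x < f y"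
proof -
  define f where "f x = (LEAST n. x \<notin> Range (R ^^ Suc n))" for x
  obtain k' where k: "k = Suc k'"
    using assms by (cases k) auto
  have "f x < k" for x
    unfolding f_def k less_Suc_eq_le using assms k by (intro Least_le) auto
  moreover have "f x < f y" if "(x, y) \<in> R" for x y
  proof -
    have "y \<in> Range (R ^^ Suc n)" if "n \<le> f x" for n
    proof (cases n)
      case 0
      then show ?thesis using \<open>(x, y) \<in> R\<close> by auto
    next
      case (Suc n')
      with that have "x \<in> Range (R ^^ Suc n')"
        using not_less_Least[of n' "\<lambda>n. x \<notin> Range (R ^^ Suc n)"] by (auto simp: f_def)
      with Suc \<open>(x, y) \<in> R\<close> show ?thesis by (auto intro: relpow_Suc_I)
    qed
    moreover have "y \<notin> Range (R ^^ Suc (f y))"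
      unfolding f_def by (rule LeastI[of _ k']) (use assms k in auto)
    ultimately show ?thesis by (meson not_less)
  qed
  ultimately show thesis by (rule that)
qed

section \<open>Breadth-first search\<close>

text \<open>Since \<open>z 0\<close> and \<open>z k\<close> coincide, injectivity starts at 1, just
  as library cycles have a distinct tail of the vertex list.\<close>

definition closed_path :: "'a rel \<Rightarrow> nat \<Rightarrow> (nat \<Rightarrow> 'a) \<Rightarrow> bool" where
  "closed_path E k z \<longleftrightarrow> z k = z 0 \<and> inj_on z {1..k} \<and> (\<forall>c<k. (z c, z (Suc c)) \<in> E)"

locale rooted_graph =
  fixes E :: "'a rel" and v :: 'a
  assumes sym: "sym E"
begin

definition reach :: "'a set" where
  "reach = E\<^sup>* `` {v}"

definition depth :: "'a \<Rightarrow> nat" where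
  "depth u = (LEAST n. (v, u) \<in> E ^^ n)"

text \<open>One choice per vertex fixes the search tree. At \<open>v\<close> the choice is
  unspecified, so iterates are controlled only up to the depth.\<close>

definition parent :: "'a \<Rightarrow> 'a" where
  "parent u = (SOME w. (w, u) \<in> E \<and> w \<in> reach \<and> depth u = Suc (depth w))"

lemma depth_le: "(v, u) \<in> E ^^ n \<Longrightarrow> depth u \<le> n"
  unfolding depth_def by (rule Least_le)

lemma relpow_depth: "u \<in> reach \<Longrightarrow> (v, u) \<in> E ^^ depth u"
  unfolding depth_def reach_def by (auto simp: rtrancl_power intro: LeastI)

lemma reach_step: "(x, y) \<in> E \<Longrightarrow> x \<in> reach \<Longrightarrow> y \<in> reach"
  unfolding reach_def by auto

lemma depth_step: "(x, y) \<in> E \<Longrightarrow> x \<in> reach \<Longrightarrow> depth y \<le> Suc (depth x)"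
  using relpow_depth[of x] by (intro depth_le) auto

lemma parent:
  assumes "u \<in> reach" "depth u \<noteq> 0"
  shows "(parent u, u) \<in> E" "parent u \<in> reach" "depth u = Suc (depth (parent u))"
proof -
  from assms obtain n where n: "depth u = Suc n"
    by (cases "depth u") auto
  with relpow_depth[OF assms(1)] obtain w where w: "(v, w) \<in> E ^^ n" "(w, u) \<in> E"
    by auto
  have "w \<in> reach"
    using w(1) by (auto simp: reach_def rtrancl_power)
  with w n have "\<exists>w. (w, u) \<in> E \<and> w \<in> reach \<and> depth u = Suc (depth w)"
    using depth_le[OF w(1)] depth_step[of w u] by (intro exI[of _ w]) auto
  from someI_ex[OF this]
  show "(parent u, u) \<in> E" "parent u \<in> reach" "depth u = Suc (depth (parent u))"
    unfolding parent_def by auto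
qed

lemma funpow_parent:
  assumes "u \<in> reach" "j \<le> depth u"
  shows "(parent ^^ j) u \<in> reach \<and> depth ((parent ^^ j) u) = depth u - j"
  using assms(2)
proof (induction j)
  case (Suc j)
  then show ?case
    using parent[of "(parent ^^ j) u"] by auto
qed (use assms in auto)

lemma funpow_parent_arc:
  assumes "u \<in> reach" "j < depth u"
  shows "((parent ^^ Suc j) u, (parent ^^ j) u) \<in> E" "((parent ^^ j) u, (parent ^^ Suc j) u) \<in> E"
  using funpow_parent[of u j] parent(1)[of "(parent ^^ j) u"] assms sym by (auto dest: symD)

lemma funpow_parent_depth:
  assumes "u \<in> reach"
  shows "(parent ^^ depth u) u = v"
  using funpow_parent[OF assms, of "depth u"] relpow_depth[of "(parent ^^ depth u) u"] by simp

text \<open>Follow the path from \<open>s a\<close> to \<open>s b\<close>, climb \<open>m\<close>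
  generations to the common ancestor, then descend to \<open>s a\<close>.\<close>

lemma closed_path_of_fork:
  assumes s: "\<And>c. a \<le> c \<Longrightarrow> c \<le> b \<Longrightarrow> s c \<in> reach \<and> depth (s c) = i"
    and arc: "\<And>c. a \<le> c \<Longrightarrow> c < b \<Longrightarrow> (s c, s (Suc c)) \<in> E"
    and inj: "\<And>c c'. a \<le> c \<Longrightarrow> c < c' \<Longrightarrow> c' \<le> b \<Longrightarrow> s c \<noteq> s c'"
    and "a < b" "0 < m" "m \<le> i"
    and meet: "(parent ^^ m) (s a) = (parent ^^ m) (s b)"
    and fork: "\<And>j. j < m \<Longrightarrow> (parent ^^ j) (s a) \<noteq> (parent ^^ j) (s b)"
  shows "\<exists>z. closed_path E (b - a + 2 * m) z"
proof -
  define w where "w = b - a"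
  define k where "k = w + 2 * m"
  define z where "z c = (if c \<le> w then s (a + c) else if c \<le> w + m then (parent ^^ (c - w)) (s b)
    else (parent ^^ (k - c)) (s a))" for c
  have b: "a + w = b"
    using \<open>a < b\<close> by (simp add: w_def)
  have sa: "s a \<in> reach" "depth (s a) = i" and sb: "s b \<in> reach" "depth (s b) = i"
    using s[of a] s[of b] \<open>a < b\<close> by auto
  \<comment> \<open>Depths rule out most coincidences; \<open>inj\<close> handles two path
    positions, \<open>fork\<close> handles the two branches.\<close>
  have depth_z: "depth (z c) = (if c \<le> w then i else if c \<le> w + m then i - (c - w) else i - (k - c))"
    if "c \<le> k" for c
    using that s[of "a + c"] funpow_parent[OF sa(1), of "k - c"] funpow_parent[OF sb(1), of "c - w"]
      b sa sb \<open>m \<le> i\<close>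
    by (auto simp: z_def k_def)
  have "z c \<noteq> z c'" if range: "1 \<le> c" "c < c'" "c' \<le> k" for c c'
  proof
    assume eq: "z c = z c'"
    then have d: "depth (z c) = depth (z c')" by simp
    consider "c' \<le> w" | "c \<le> w" "w < c'" "c' < k" | "c \<le> w" "c' = k"
      | "w < c" "c' \<le> w + m" | "w < c" "c \<le> w + m" "w + m < c'" | "w + m < c"
      using range by linarith
    then show False
    proof cases
      case 1
      with eq that inj[of "a + c" "a + c'"] b show False by (auto simp: z_def)
    next
      case 2
      with d that depth_z[of c] depth_z[of c'] \<open>m \<le> i\<close> show False
        by (auto simp: k_def split: if_splits)
    next
      case 3
      with eq that inj[of a "a + c"] b \<open>0 < m\<close> show False by (auto simp: z_def k_def)
    next
      case 4
      with d that depth_z[of c] depth_z[of c'] \<open>m \<le> i\<close> show False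
        by (auto simp: k_def split: if_splits)
    next
      case 5
      \<comment> \<open>Equal depth on opposite branches means equal height. The meeting vertex is
        counted on the climbing side, so this height is below \<open>m\<close>.\<close>
      with d that depth_z[of c] depth_z[of c'] \<open>m \<le> i\<close> have "c - w = k - c'"
        by (auto simp: k_def split: if_splits)
      moreover have "k - c' < m"
        using 5 \<open>c' \<le> k\<close> by (simp add: k_def)
      ultimately show False
        using 5 eq fork[of "k - c'"] by (auto simp: z_def)
    next
      case 6
      with d that depth_z[of c] depth_z[of c'] \<open>m \<le> i\<close> show False
        by (auto simp: k_def split: if_splits)
    qed
  qed
  then have "inj_on z {1..k}"
    by (intro linorder_inj_onI) auto
  moreover have "z k = z 0"
    using \<open>0 < m\<close> by (simp add: z_def k_def)
  moreover have "(z c, z (Suc c)) \<in> E" if "c < k" for c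
  proof -
    consider "c < w" | "w \<le> c" "c < w + m" | "w + m \<le> c"
      by linarith
    then show ?thesis
    proof cases
      case 1
      with arc[of "a + c"] b show ?thesis by (auto simp: z_def)
    next
      case 2
      then have "z c = (parent ^^ (c - w)) (s b)" "z (Suc c) = (parent ^^ Suc (c - w)) (s b)"
        using b by (auto simp: z_def Suc_diff_le simp del: funpow.simps)
      with funpow_parent_arc(2)[OF sb(1), of "c - w"] 2 sb \<open>m \<le> i\<close> show ?thesis by simp
    next
      case 3
      \<comment> \<open>At \<open>c = w + m\<close> the vertex is defined from \<open>s b\<close>;
        \<open>meet\<close> makes it an ancestor of \<open>s a\<close>.\<close>
      then have "z c = (parent ^^ Suc (k - Suc c)) (s a)" "z (Suc c) = (parent ^^ (k - Suc c)) (s a)"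
        using that meet \<open>0 < m\<close>
        by (auto simp: z_def k_def Suc_diff_Suc le_Suc_eq simp del: funpow.simps)
      with funpow_parent_arc(1)[OF sa(1), of "k - Suc c"] 3 that sa \<open>m \<le> i\<close> show ?thesis
        by (simp add: k_def)
    qed
  qed
  ultimately show ?thesis
    unfolding closed_path_def k_def w_def by blast
qed

lemma closed_path_of_increasing_path:
  assumes r: "irrefl r" "trans r"
    and s: "\<And>c. c \<le> k \<Longrightarrow> s c \<in> reach \<and> depth (s c) = i"
    and arc: "\<And>c. c < k \<Longrightarrow> (s c, s (Suc c)) \<in> E"
    and less: "\<And>c. c < k \<Longrightarrow> tree_less r parent i (s c) (s (Suc c))"
    and "0 < k" "2 * i \<le> Suc k"
  shows "\<exists>z. closed_path E (k + 2) z"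
proof -
  \<comment> \<open>Height of the last common ancestor of the whole path, expressed through
    consecutive vertices.\<close>
  define m where "m = (LEAST j. \<forall>c<k. (parent ^^ j) (s c) = (parent ^^ j) (s (Suc c)))"
  have root: "\<forall>c<k. (parent ^^ i) (s c) = (parent ^^ i) (s (Suc c))"
    using s funpow_parent_depth by (metis Suc_leI less_imp_le)
  then have "m \<le> i"
    unfolding m_def by (rule Least_le)
  have m: "\<forall>c<k. (parent ^^ m) (s c) = (parent ^^ m) (s (Suc c))"
    unfolding m_def using root by (rule LeastI)
  have const: "(parent ^^ m) (s c) = (parent ^^ m) (s 0)" if "c \<le> k" for c
    using that m by (induction c) auto
  have "s 0 \<noteq> s (Suc 0)"
    using less[of 0] \<open>0 < k\<close> tree_less_irrefl[OF r(1)] by metis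
  with m \<open>0 < k\<close> have "0 < m"
    by (cases m) auto
  \<comment> \<open>By minimality of \<open>m\<close>, step \<open>c\<close> crosses between two
    child subtrees of that ancestor.\<close>
  then obtain c where c: "c < k" "(parent ^^ (m - 1)) (s c) \<noteq> (parent ^^ (m - 1)) (s (Suc c))"
    using not_less_Least[of "m - 1" "\<lambda>j. \<forall>c<k. (parent ^^ j) (s c) = (parent ^^ j) (s (Suc c))"]
    by (auto simp: m_def[symmetric])
  define w where "w = k + 2 - 2 * m"
  \<comment> \<open>The window of \<open>w\<close> steps starts at \<open>c\<close>, shifted left if
    it would overrun the path; it still contains step \<open>c\<close>.\<close>
  define a where "a = min c (k - w)"
  have w: "1 \<le> w" "w \<le> k" "w + 2 * m = k + 2"
    using \<open>0 < m\<close> \<open>m \<le> i\<close> \<open>2 * i \<le> Suc k\<close> by (auto simp: w_def)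
  have a: "a \<le> c" "Suc c \<le> a + w" "a + w \<le> k"
    using w c(1) by (auto simp: a_def)
  have chain: "s c = s c' \<or> tree_less r parent i (s c) (s c')" if "c \<le> c'" "c' \<le> k" for c c'
    using r(2) less that by (rule tree_less_chain)
  have "(parent ^^ j) (s a) \<noteq> (parent ^^ j) (s (a + w))" if "j < m" for j
  proof
    assume "(parent ^^ j) (s a) = (parent ^^ j) (s (a + w))"
    then have "(parent ^^ (m - 1 - j)) ((parent ^^ j) (s a))
        = (parent ^^ (m - 1 - j)) ((parent ^^ j) (s (a + w)))"
      by simp
    then have eq: "(parent ^^ (m - 1)) (s a) = (parent ^^ (m - 1)) (s (a + w))"
      using that by (simp flip: funpow_add[THEN fun_cong, unfolded comp_apply])
    \<comment> \<open>An earlier meeting of the ends would squeeze the whole window into one child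
      subtree, contradicting the choice of \<open>c\<close>.\<close>
    have "(parent ^^ (m - 1)) (s a) = (parent ^^ (m - 1)) (s c')" if "a \<le> c'" "c' \<le> a + w" for c'
      by (rule tree_less_between[OF r _ chain chain eq]) (use that a(3) \<open>m \<le> i\<close> in auto)
    from this[of c] this[of "Suc c"] a c(2) show False by simp
  qed
  moreover have "s c \<noteq> s c'" if "c < c'" "c' \<le> k" for c c'
    using r less that by (rule tree_less_chain_inj)
  ultimately have "\<exists>z. closed_path E (a + w - a + 2 * m) z"
    using s arc a(3) w \<open>0 < m\<close> \<open>m \<le> i\<close> const[of a] const[of "a + w"]
    by (intro closed_path_of_fork[of a "a + w" s i m]) auto
  with w show ?thesis by simp
qed

lemma level_colouring:
  assumes "\<nexists>z. closed_path E (k + 2) z" "0 < k" "2 * i \<le> Suc k"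
  shows "\<exists>f :: 'a \<Rightarrow> nat. (\<forall>x. f x < k) \<and>
    (\<forall>x y. (x, y) \<in> E \<longrightarrow> x \<in> reach \<longrightarrow> x \<noteq> y \<longrightarrow> depth x = i \<longrightarrow> depth y = i \<longrightarrow> f x \<noteq> f y)"
proof -
  \<comment> \<open>Serves only as a source of a strict total order for siblings, also in infinite
    graphs.\<close>
  obtain r0 :: "'a rel" where r0: "Well_order r0" "Field r0 = UNIV"
    using well_ordering by metis
  define r where "r = r0 - Id"
  have r: "irrefl r" "trans r" "total r"
    using r0 trans_diff_Id[of r0] by (simp_all add: r_def order_on_defs irrefl_def)
  define R where "R = {(x, y) \<in> E. x \<in> reach \<and> depth x = i \<and> depth y = i
    \<and> tree_less r parent i x y}"
  have "R ^^ k = {}"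
  proof (rule ccontr)
    assume "R ^^ k \<noteq> {}"
    then obtain s where "\<forall>c<k. (s c, s (Suc c)) \<in> R"
      by (auto simp: relpow_fun_conv)
    then have s: "(s c, s (Suc c)) \<in> R" if "c < k" for c
      using that by blast
    have "s c \<in> reach \<and> depth (s c) = i" if "c \<le> k" for c
      using that s[of c] s[of "c - 1"] \<open>0 < k\<close> reach_step
      by (cases "c < k") (auto simp: R_def)
    with s have "\<exists>z. closed_path E (k + 2) z"
      using assms(2,3) by (intro closed_path_of_increasing_path[OF r(1,2), of k s i]) (auto simp: R_def)
    with assms(1) show False by blast
  qed
  then obtain f :: "'a \<Rightarrow> nat" where f: "\<And>x. f x < k" "\<And>x y. (x, y) \<in> R \<Longrightarrow> f x < f y"
    by (erule colouring_of_no_relpow)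
  have "f x \<noteq> f y" if "(x, y) \<in> E" "x \<in> reach" "x \<noteq> y" "depth x = i" "depth y = i" for x y
  proof -
    have "y \<in> reach" "(y, x) \<in> E"
      using that reach_step sym by (auto dest: symD)
    \<comment> \<open>Both ancestors are the root, so any two distinct vertices of the level are
      comparable.\<close>
    moreover have "(parent ^^ i) x = (parent ^^ i) y"
      using that \<open>y \<in> reach\<close> funpow_parent_depth by metis
    ultimately have "(x, y) \<in> R \<or> (y, x) \<in> R"
      using that tree_less_total[OF r(3), of i parent x y] by (auto simp: R_def)
    then show ?thesis using f(2) by fastforce
  qed
  with f(1) show ?thesis by blast
qed

lemma ball_colouring:
  assumes "\<nexists>z. closed_path E (k + 2) z" "0 < k" "2 * t \<le> Suc k" "irrefl E"
  obtains c :: "'a \<Rightarrow> nat" where "\<And>x. c x < 2 * k"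
    "\<And>x y. (x, y) \<in> E \<Longrightarrow> x \<in> reach \<Longrightarrow> depth x \<le> t \<Longrightarrow> c x \<noteq> c y"
proof -
  have "\<forall>i\<in>{..t}. \<exists>f :: 'a \<Rightarrow> nat. (\<forall>x. f x < k) \<and>
      (\<forall>x y. (x, y) \<in> E \<longrightarrow> x \<in> reach \<longrightarrow> x \<noteq> y \<longrightarrow> depth x = i \<longrightarrow> depth y = i \<longrightarrow> f x \<noteq> f y)"
    using assms by (intro ballI level_colouring) auto
  from bchoice[OF this] obtain f :: "nat \<Rightarrow> 'a \<Rightarrow> nat"
    where "\<forall>i\<in>{..t}. (\<forall>x. f i x < k) \<and> (\<forall>x y. (x, y) \<in> E \<longrightarrow> x \<in> reach \<longrightarrow> x \<noteq> y \<longrightarrow>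
      depth x = i \<longrightarrow> depth y = i \<longrightarrow> f i x \<noteq> f i y)"
    by blast
  then have f: "\<And>i x. i \<le> t \<Longrightarrow> f i x < k"
    "\<And>i x y. i \<le> t \<Longrightarrow> (x, y) \<in> E \<Longrightarrow> x \<in> reach \<Longrightarrow> x \<noteq> y \<Longrightarrow> depth x = i \<Longrightarrow> depth y = i
      \<Longrightarrow> f i x \<noteq> f i y"
    by auto
  \<comment> \<open>The depth parity selects a palette of size \<open>k\<close>;
    \<open>min t\<close> keeps colours in range outside the ball.\<close>
  define c where "c x = (depth x mod 2) * k + f (min t (depth x)) x" for x
  have f': "f (min t i) x < k" for i x
    using f(1) by simp
  have parity: "c x div k = depth x mod 2" "c x mod k = f (min t (depth x)) x" for x
    using f'[of "depth x" x] by (simp_all add: c_def)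
  have "c x < 2 * k" for x
    using parity(1)[of x] \<open>0 < k\<close> by (metis less_mult_imp_div_less div_less_iff_less_mult mod_less_divisor pos2)
  moreover have "c x \<noteq> c y" if "(x, y) \<in> E" "x \<in> reach" "depth x \<le> t" for x y
  proof
    assume "c x = c y"
    with parity have mod: "depth x mod 2 = depth y mod 2"
      and feq: "f (min t (depth x)) x = f (min t (depth y)) y"
      by metis+
    have "depth y \<le> Suc (depth x)" "depth x \<le> Suc (depth y)"
      using that depth_step reach_step sym by (auto dest: symD)
    with mod have "depth x = depth y"
      by presburger
    then have "f (depth x) x = f (depth x) y"
      using feq that(3) by (simp add: min_absorb2)
    moreover have "x \<noteq> y"
      using that(1) \<open>irrefl E\<close> by (auto simp: irrefl_def)
    ultimately show False
      using f(2)[OF that(3,1,2) _ refl] \<open>depth x = depth y\<close> by metis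
  qed
  ultimately show thesis by (rule that)
qed

end

section \<open>Transfer to the graph library\<close>

context pair_wf_digraph
begin

lemma awalk_of_sequence:
  assumes "\<forall>c<n. (z c, z (Suc c)) \<in> parcs G" "z 0 \<in> pverts G"
  shows "awalk (z 0) (map (\<lambda>c. (z c, z (Suc c))) [0..<n]) (z n)"
    and "awalk_verts (z 0) (map (\<lambda>c. (z c, z (Suc c))) [0..<n]) = map z [0..<Suc n]"
proof -
  show "awalk (z 0) (map (\<lambda>c. (z c, z (Suc c))) [0..<n]) (z n)"
    using assms by (induction n) (auto simp: awalk_Nil_iff awalk_simps in_arcsD2)
  show "awalk_verts (z 0) (map (\<lambda>c. (z c, z (Suc c))) [0..<n]) = map z [0..<Suc n]"
    by (induction n) (auto simp: awalk_verts_conv)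
qed

lemma cycle_of_closed_path:
  assumes "closed_path (parcs G) n z" "0 < n"
  shows "\<exists>p. cycle p \<and> length p = n"
proof -
  let ?p = "map (\<lambda>c. (z c, z (Suc c))) [0..<n]"
  from assms have *: "\<forall>c<n. (z c, z (Suc c)) \<in> parcs G" "z 0 \<in> pverts G" "z n = z 0"
    by (auto simp: closed_path_def intro: in_arcsD1)
  have "tl (map z [0..<Suc n]) = map z [1..<Suc n]"
    by (simp add: upt_conv_Cons del: upt_Suc)
  moreover have "distinct (map z [1..<Suc n])"
    using assms(1) by (simp add: closed_path_def distinct_map atLeastLessThanSuc_atLeastAtMost del: upt_Suc)
  ultimately have "cycle ?p"
    unfolding cycle_def using awalk_of_sequence[of n z] * \<open>0 < n\<close>
    by (intro exI[of _ "z 0"]) auto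
  then show ?thesis by (intro exI[of _ ?p]) auto
qed

lemma awalk_imp_relpow: "awalk u p w \<Longrightarrow> (u, w) \<in> parcs G ^^ length p"
proof (induction p arbitrary: u)
  case (Cons e p)
  then show ?case
    by (cases e) (auto simp: awalk_Cons_iff simp del: relpow.simps intro: relpow_Suc_I2)
qed (auto simp: awalk_Nil_iff)

lemma relpow_of_gdist_le:
  assumes "gdist (with_proj G) u w \<le> ereal (real t)"
  shows "\<exists>n\<le>t. (u, w) \<in> parcs G ^^ n"
proof -
  \<comment> \<open>The strict bound makes the infimum yield an actual walk; integrality of its
    length brings \<open>t + 1\<close> back to \<open>t\<close>.\<close>
  have "\<mu> (\<lambda>_. 1) u w < ereal (real t + 1)"
    using assms unfolding gdist_def by (rule le_less_trans) simp
  then obtain p where p: "awalk u p w" "awalk_cost (\<lambda>_. 1) p < real t + 1"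
    by (auto simp: \<mu>_def INF_less_iff)
  have "awalk_cost (\<lambda>_. 1) p = real (length p)"
    by (induction p) auto
  with p show ?thesis
    using awalk_imp_relpow[OF p(1)] by (intro exI[of _ "length p"]) auto
qed

end

theorem theorem7p1:
  fixes G :: "'a pair_pre_digraph" and l t :: nat
  assumes "l \<ge> 2"
    and "pair_bidirected_digraph G"
    and "cycle_free (l + 1) (with_proj G)"
    and "t = l div 2"
  shows "\<forall>v \<in> pverts G. chromatic_number (gball (with_proj G) t v) \<le> enat (2 * l)"
proof
  fix v assume "v \<in> pverts G"
  interpret pair_bidirected_digraph G by fact
  interpret T: rooted_graph "parcs G" v
    by unfold_locales (auto intro: symI arcs_symmetric)
  have "\<nexists>z. closed_path (parcs G) (l - 1 + 2) z"
    using cycle_of_closed_path[of "l + 1"] assms(1,3) by (auto simp: cycle_free_def)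
  moreover have "irrefl (parcs G)"
    using pair_no_loops by (force simp: irrefl_def)
  \<comment> \<open>Here \<open>k = l - 1\<close>: the forbidden length is \<open>k + 2\<close>, and
    \<open>2 * t \<le> l = Suc k\<close>.\<close>
  ultimately obtain c :: "'a \<Rightarrow> nat" where c: "\<And>x. c x < 2 * (l - 1)"
    "\<And>x y. (x, y) \<in> parcs G \<Longrightarrow> x \<in> T.reach \<Longrightarrow> T.depth x \<le> t \<Longrightarrow> c x \<noteq> c y"
    using T.ball_colouring[of "l - 1" t] assms(1,4) by auto
  have ball: "x \<in> T.reach \<and> T.depth x \<le> t" if "gdist (with_proj G) v x \<le> ereal (real t)" for x
    using relpow_of_gdist_le[OF that] T.depth_le
    by (auto simp: T.reach_def rtrancl_power intro: order_trans)
  have "colourable (2 * l) (gball (with_proj G) t v)"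
    unfolding colourable_def
  proof (intro exI[of _ c] conjI allI impI)
    show "c ` verts (gball (with_proj G) t v) \<subseteq> {..<2 * l}"
      using less_le_trans[OF c(1), of "2 * l"] by auto
    fix x y assume "x \<rightarrow>\<^bsub>gball (with_proj G) t v\<^esub> y"
    then have "(x, y) \<in> parcs G" "gdist (with_proj G) v x \<le> ereal (real t)"
      by (auto simp: gball_def arcs_ends_def arc_to_ends_def)
    then show "c x \<noteq> c y"
      using c(2) ball by blast
  qed
  then show "chromatic_number (gball (with_proj G) t v) \<le> enat (2 * l)"
    unfolding chromatic_number_def by (intro INF_lower) simp
qed

end
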